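(* Let $A,B$ be $n\times n$ Hermitian positive definite matrices. Let scalars $t$ and $u$ satisfy $1\le t\le u<\infty$. Then $$t^{-1}\delta_R(A^t,B^t)\le u^{-1}\delta_R(A^u,B^u)$$ and $$t^{-1}\delta_S^2(A^t,B^t)\le u^{-1}\delta_S^2(A^u,B^u).$$
   Context: For Hermitian positive definite $X,Y$: $\delta_R(X,Y):=\|\log(Y^{-1/2}XY^{-1/2})\|_F$, where $\log$ is the matrix logarithm and $\|\cdot\|_F$ the Frobenius norm, and $\delta_S^2(X,Y):=\log\det\left(\frac{X+Y}{2}\right)-\frac12\log\det(XY)$. *)

theory Defs
  imports "HOL-Analysis.Analysis"
begin

definition adjoint_mat :: "complex ^ 'm ^ 'n \<Rightarrow> complex ^ 'n ^ 'm" where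
  "adjoint_mat A = (\<chi> i j. cnj (A $ j $ i))"

definition hermitian_mat :: "complex ^ 'n ^ 'n \<Rightarrow> bool" where
  "hermitian_mat A \<longleftrightarrow> adjoint_mat A = A"

text \<open>For Hermitian \<open>A\<close> the form \<open>x\<^sup>* A x\<close> is real, so taking its real part loses nothing.\<close>

definition hpd_mat :: "complex ^ 'n ^ 'n \<Rightarrow> bool" where
  "hpd_mat A \<longleftrightarrow> hermitian_mat A \<and>
     (\<forall>x. x \<noteq> 0 \<longrightarrow> 0 < Re (\<Sum>i\<in>UNIV. cnj (x $ i) * (A *v x) $ i))"

definition unitary_mat :: "complex ^ 'n ^ 'n \<Rightarrow> bool" where
  "unitary_mat U \<longleftrightarrow> adjoint_mat U ** U = mat 1 \<and> U ** adjoint_mat U = mat 1"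

definition diag_mat :: "('n \<Rightarrow> real) \<Rightarrow> complex ^ 'n ^ 'n" where
  "diag_mat d = (\<chi> i j. if i = j then complex_of_real (d i) else 0)"

text \<open>The function \<open>f\<close> applied to a Hermitian matrix through any unitary diagonalization. The
  result does not depend on the diagonalization, see \<open>mat_fun_unique\<close> and \<open>mat_fun_diag\<close> below.\<close>

definition mat_fun :: "(real \<Rightarrow> real) \<Rightarrow> complex ^ 'n ^ 'n \<Rightarrow> complex ^ 'n ^ 'n" where
  "mat_fun f A = (THE B. \<exists>U d. unitary_mat U \<and>
      A = U ** diag_mat d ** adjoint_mat U \<and>
      B = U ** diag_mat (\<lambda>i. f (d i)) ** adjoint_mat U)"

definition mat_powr :: "complex ^ 'n ^ 'n \<Rightarrow> real \<Rightarrow> complex ^ 'n ^ 'n" where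
  "mat_powr A t = mat_fun (\<lambda>x. x powr t) A"

definition mat_log :: "complex ^ 'n ^ 'n \<Rightarrow> complex ^ 'n ^ 'n" where
  "mat_log A = mat_fun ln A"

text \<open>The library norm on \<open>complex ^ 'n ^ 'n\<close> is the Frobenius norm, see \<open>norm_eq_frobenius\<close>.\<close>

definition delta_R :: "complex ^ 'n ^ 'n \<Rightarrow> complex ^ 'n ^ 'n \<Rightarrow> real" where
  "delta_R X Y = norm (mat_log (mat_powr Y (- 1 / 2) ** X ** mat_powr Y (- 1 / 2)))"

text \<open>This is the squared quantity \<open>\<delta>\<^sub>S\<^sup>2\<close>. Both determinants are positive reals when \<open>X\<close> and \<open>Y\<close>
  are Hermitian positive definite, hence the real parts.\<close>

definition delta_S_sq :: "complex ^ 'n ^ 'n \<Rightarrow> complex ^ 'n ^ 'n \<Rightarrow> real" where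
  "delta_S_sq X Y =
     ln (Re (det ((1 / 2) *\<^sub>R (X + Y)))) - 1 / 2 * ln (Re (det (X ** Y)))"

lemma norm_eq_frobenius:
  fixes A :: "complex ^ 'm ^ 'n"
  shows "norm A = sqrt (\<Sum>i\<in>UNIV. \<Sum>j\<in>UNIV. (cmod (A $ i $ j))\<^sup>2)"
  by (simp add: norm_vec_def L2_set_def sum_nonneg)

lemma diag_mat_mult_nth:
  fixes W :: "complex ^ 'n ^ 'n"
  shows "(W ** diag_mat d) $ i $ j = W $ i $ j * d j"
    and "(diag_mat d ** W) $ i $ j = d i * W $ i $ j"
  by (simp_all add: matrix_matrix_mult_def diag_mat_def if_distrib if_distribR cong: if_cong)

lemma mat_fun_unique:
  fixes U V :: "complex ^ 'n ^ 'n"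
  assumes U: "unitary_mat U" and V: "unitary_mat V"
    and eq: "U ** diag_mat d ** adjoint_mat U = V ** diag_mat e ** adjoint_mat V"
  shows "U ** diag_mat (\<lambda>i. f (d i)) ** adjoint_mat U
       = V ** diag_mat (\<lambda>i. f (e i)) ** adjoint_mat V"
proof -
  define W where "W = adjoint_mat V ** U"
  have UU: "adjoint_mat U ** U = mat 1" "U ** adjoint_mat U = mat 1"
    and VV: "adjoint_mat V ** V = mat 1" "V ** adjoint_mat V = mat 1"
    using U V by (auto simp: unitary_mat_def)
  have "W ** diag_mat d = adjoint_mat V ** (U ** diag_mat d ** adjoint_mat U) ** U"
    unfolding W_def by (metis UU(1) matrix_mul_assoc matrix_mul_rid)
  also have "\<dots> = diag_mat e ** W"
    unfolding W_def eq by (metis VV(1) matrix_mul_assoc matrix_mul_lid)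
  finally have WD: "W ** diag_mat d = diag_mat e ** W" .
  have "W $ i $ j * f (d j) = f (e i) * W $ i $ j" for i j
    using arg_cong[OF WD, of "\<lambda>M. M $ i $ j"] by (auto simp: diag_mat_mult_nth)
  then have Wf: "W ** diag_mat (\<lambda>i. f (d i)) = diag_mat (\<lambda>i. f (e i)) ** W"
    by (simp add: vec_eq_iff diag_mat_mult_nth)
  have VW: "V ** W = U" and WU: "W ** adjoint_mat U = adjoint_mat V"
    unfolding W_def using UU VV by (metis matrix_mul_assoc matrix_mul_lid matrix_mul_rid)+
  have "U ** diag_mat (\<lambda>i. f (d i)) ** adjoint_mat U
      = V ** (W ** diag_mat (\<lambda>i. f (d i))) ** adjoint_mat U"
    by (simp add: VW matrix_mul_assoc)
  also have "\<dots> = V ** diag_mat (\<lambda>i. f (e i)) ** (W ** adjoint_mat U)"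
    by (simp add: Wf matrix_mul_assoc)
  finally show ?thesis by (simp add: WU)
qed

lemma mat_fun_diag:
  assumes "unitary_mat U"
  shows "mat_fun f (U ** diag_mat d ** adjoint_mat U)
       = U ** diag_mat (\<lambda>i. f (d i)) ** adjoint_mat U"
  unfolding mat_fun_def using assms by (intro the_equality) (blast, metis mat_fun_unique)

end

theory Submission imports Defs begin

text \<open>Write \<open>K s = B\<^bsup>-s/2\<^esup> A\<^bsup>s\<^esup> B\<^bsup>-s/2\<^esup>\<close> with eigenvalues \<open>exp (x\<^sub>i s)\<close>. Both \<open>\<delta>\<^sub>R\<close> and \<open>\<delta>\<^sub>S\<^sup>2\<close> are
  functions of these eigenvalues, the latter through \<open>ln det (1 + K s)\<close>.
  The functional \<open>M \<mapsto> det (1 + M)\<close> shares with the trace the Cauchy-Schwarz inequality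
  \<open>\<bar>det (1 + S\<^sup>* T)\<bar>\<^sup>2 \<le> det (1 + S\<^sup>* S) det (1 + T\<^sup>* T)\<close> and cyclicity. These alone show that
  \<open>s \<mapsto> ln det (1 + (K s)\<^sup>p)\<close> is midpoint convex for every \<open>p = 2\<^sup>j\<close>, hence lies below its chords from
  \<open>s = 0\<close>; the case \<open>p = 1\<close> is the claim for \<open>\<delta>\<^sub>S\<^sup>2\<close>. Replacing \<open>A\<close> by multiples of \<open>A\<close> and letting
  \<open>p\<close> tend to infinity, the sums of \<open>max 0 (x\<^sub>i s / s - a)\<close> over \<open>i\<close> increase with \<open>s\<close> for all \<open>a\<close>, and
  likewise for \<open>- x\<^sub>i\<close>. Integrating over \<open>a \<ge> 0\<close> gives the monotonicity of the sum of
  \<open>(x\<^sub>i s / s)\<^sup>2\<close>, which is the claim for \<open>\<delta>\<^sub>R\<close>.\<close>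

section \<open>Unitary diagonalization of Hermitian matrices\<close>

lemma matrix_add_rdistrib: "(A + B) ** C = A ** C + B ** (C :: 'a::semiring_1 ^ 'p ^ 'n)"
  by (vector matrix_matrix_mult_def sum.distrib[symmetric] field_simps)

lemma matrix_diff_ldistrib: "A ** (B - C) = A ** B - A ** (C :: 'a::ring_1 ^ 'p ^ 'n)"
  by (simp add: vec_eq_iff matrix_matrix_mult_def sum_subtractf algebra_simps)

lemma matrix_diff_rdistrib: "(A - B) ** C = A ** C - B ** (C :: 'a::ring_1 ^ 'p ^ 'n)"
  by (simp add: vec_eq_iff matrix_matrix_mult_def sum_subtractf algebra_simps)

lemma scaleR_matrix_mult_left: "(c *\<^sub>R A) ** B = c *\<^sub>R (A ** B)"
  for A :: "'a::real_algebra_1 ^ 'n ^ 'm"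
  by (simp add: vec_eq_iff matrix_matrix_mult_def scaleR_sum_right)

lemma scaleR_matrix_mult_right: "A ** (c *\<^sub>R B) = c *\<^sub>R (A ** B)"
  for A :: "'a::real_algebra_1 ^ 'n ^ 'm"
  by (simp add: vec_eq_iff matrix_matrix_mult_def scaleR_sum_right)

lemma continuous_on_matrix_mult [continuous_intros]:
  fixes f :: "'b::topological_space \<Rightarrow> 'a::real_normed_field ^ 'n ^ 'm"
  assumes "continuous_on S f" "continuous_on S g"
  shows "continuous_on S (\<lambda>x. f x ** g x)"
  unfolding matrix_matrix_mult_def using assms by (intro continuous_intros)

lemma continuous_on_det [continuous_intros]:
  fixes f :: "'b::topological_space \<Rightarrow> 'a::real_normed_field ^ 'n ^ 'n"
  assumes "continuous_on S f"
  shows "continuous_on S (\<lambda>x. det (f x))"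
  unfolding det_def using assms by (intro continuous_intros)

lemma det_similar:
  fixes X :: "'a::field ^ 'n ^ 'n"
  assumes "X ** Y = mat 1"
  shows "det (X ** M ** Y) = det M"
proof -
  have "det X * det Y = 1"
    using assms by (metis det_I det_mul)
  then show ?thesis
    by (simp add: det_mul mult.commute mult.left_commute)
qed

lemma adjoint_mat_adjoint [simp]: "adjoint_mat (adjoint_mat A) = A"
  by (simp add: adjoint_mat_def vec_eq_iff)

lemma adjoint_mat_mult: "adjoint_mat (A ** B) = adjoint_mat B ** adjoint_mat A"
  by (simp add: adjoint_mat_def vec_eq_iff matrix_matrix_mult_def mult.commute)

lemma adjoint_mat_add: "adjoint_mat (A + B) = adjoint_mat A + adjoint_mat B"
  by (simp add: adjoint_mat_def vec_eq_iff)

lemma adjoint_mat_diff: "adjoint_mat (A - B) = adjoint_mat A - adjoint_mat B"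
  by (simp add: adjoint_mat_def vec_eq_iff)

lemma adjoint_mat_one [simp]: "adjoint_mat (mat 1) = mat 1"
  by (auto simp: adjoint_mat_def vec_eq_iff mat_def)

lemma adjoint_diag_mat [simp]: "adjoint_mat (diag_mat d) = diag_mat d"
  by (auto simp: adjoint_mat_def vec_eq_iff diag_mat_def)

lemma det_adjoint_mat: "det (adjoint_mat A) = cnj (det A)"
proof -
  have "adjoint_mat A = transpose (\<chi> i j. cnj (A $ i $ j))"
    by (simp add: adjoint_mat_def transpose_def)
  then have "det (adjoint_mat A) = det (\<chi> i j. cnj (A $ i $ j))"
    by (metis det_transpose)
  also have "\<dots> = cnj (det A)"
    by (simp add: det_def)
  finally show ?thesis .
qed

section \<open>The complex inner product and the spectral theorem\<close>

definition cdot :: "complex ^ 'n \<Rightarrow> complex ^ 'n \<Rightarrow> complex" where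
  "cdot x y = (\<Sum>i\<in>UNIV. cnj (x $ i) * y $ i)"

lemma cdot_add_right: "cdot x (y + z) = cdot x y + cdot x z"
  and cdot_diff_right: "cdot x (y - z) = cdot x y - cdot x z"
  and cdot_smult_right: "cdot x (c *s y) = c * cdot x y"
  and cdot_scaleR_right: "cdot x (r *\<^sub>R y) = of_real r * cdot x y"
  and cdot_smult_left: "cdot (c *s x) y = cnj c * cdot x y"
  by (simp_all add: cdot_def sum.distrib sum_subtractf sum_distrib_left algebra_simps
      scaleR_conv_of_real[where 'a = complex])

lemma cnj_cdot: "cnj (cdot x y) = cdot y x"
  by (simp add: cdot_def mult.commute)

text \<open>Since \<open>\<bullet>\<close> is the real inner product, real arguments about
  orthogonality and maxima become available for \<open>cdot\<close>.\<close>

lemma Re_cdot: "Re (cdot x y) = x \<bullet> y"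
  by (simp add: cdot_def inner_vec_def inner_complex_def)

lemma cdot_self: "cdot x x = of_real ((norm x)\<^sup>2)"
proof -
  have "cdot x x = of_real (Re (cdot x x))"
    using cnj_cdot[of x x] by (simp add: complex_eq_iff)
  then show ?thesis
    by (simp add: Re_cdot power2_norm_eq_inner)
qed

lemma cdot_adjoint: "cdot x (A *v y) = cdot (adjoint_mat A *v x) y"
proof -
  have "cdot x (A *v y) = (\<Sum>i\<in>UNIV. \<Sum>j\<in>UNIV. cnj (x $ i) * (A $ i $ j * y $ j))"
    by (simp add: cdot_def matrix_vector_mult_def sum_distrib_left)
  also have "\<dots> = (\<Sum>j\<in>UNIV. \<Sum>i\<in>UNIV. cnj (x $ i) * (A $ i $ j * y $ j))"
    by (rule sum.swap)
  also have "\<dots> = cdot (adjoint_mat A *v x) y"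
    by (simp add: cdot_def matrix_vector_mult_def adjoint_mat_def sum_distrib_left mult_ac)
  finally show ?thesis .
qed

text \<open>A maximizer \<open>x\<close> of the Rayleigh quotient on the unit sphere of the
  orthogonal complement \<open>C\<close> of the given eigenvectors is itself an eigenvector:
  \<open>A\<close> maps \<open>C\<close> into itself, so the residual at \<open>x\<close> is an
  admissible direction of variation.\<close>

lemma hermitian_orthonormal_extend:
  fixes A :: "complex ^ 'n ^ 'n" and u :: "'n \<Rightarrow> complex ^ 'n"
  assumes A: "hermitian_mat A" and S: "S \<noteq> UNIV"
    and eig: "\<And>i. i \<in> S \<Longrightarrow> A *v u i = of_real (d i) *s u i"
  obtains x m where "norm x = 1" "\<And>i. i \<in> S \<Longrightarrow> cdot (u i) x = 0"
    "A *v x = complex_of_real m *s x"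
proof -
  define C where "C = {x. \<forall>i\<in>S. cdot (u i) x = 0}"
  define f where "f x = x \<bullet> (A *v x)" for x
  have AA: "adjoint_mat A = A"
    using A by (simp add: hermitian_mat_def)
  have sym: "x \<bullet> (A *v y) = y \<bullet> (A *v x)" for x y
    by (metis AA Re_cdot cdot_adjoint inner_commute)
  have CA: "A *v x \<in> C" if "x \<in> C" for x
    using that unfolding C_def by (simp add: cdot_adjoint AA eig cdot_smult_left)
  have C_lin: "x + y \<in> C" "x - y \<in> C" "r *\<^sub>R x \<in> C" if "x \<in> C" "y \<in> C" for x y r
    using that unfolding C_def
    by (simp_all add: cdot_add_right cdot_diff_right cdot_scaleR_right)
  \<comment> \<open>Real orthogonality to both \<open>u i\<close> and \<open>\<i> *s u i\<close> is
    complex orthogonality to \<open>u i\<close>. The real dimension of the space is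
    \<open>2 * CARD('n)\<close>, so these at most \<open>2 * card S\<close> conditions have a
    nonzero solution.\<close>
  define T where "T = u ` S \<union> (\<lambda>i. \<i> *s u i) ` S"
  have "dim T \<le> card T"
    by (rule dim_le_card) (auto simp: T_def span_base)
  also have "\<dots> \<le> card S + card S"
    unfolding T_def by (intro order.trans[OF card_Un_le] add_mono card_image_le finite)
  also have "\<dots> < DIM(complex ^ 'n)"
    using psubset_card_mono[of "UNIV :: 'n set" S] S by (simp add: psubset_eq)
  finally have "dim T < DIM(complex ^ 'n)" .
  from orthogonal_to_subspace_exists[OF this]
  obtain y where y: "y \<noteq> 0" "\<And>z. z \<in> span T \<Longrightarrow> orthogonal y z"
    by blast
  have "cdot (u i) y = 0" if "i \<in> S" for i
  proof -
    have "Re (cdot (u i) y) = 0" "Re (cdot (\<i> *s u i) y) = 0"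
      using y(2)[of "u i"] y(2)[of "\<i> *s u i"] that
      by (auto simp: Re_cdot orthogonal_def T_def span_base inner_commute)
    then show ?thesis
      by (simp add: cdot_smult_left complex_eq_iff)
  qed
  then have yC: "y \<in> C"
    by (simp add: C_def)
  have "continuous_on UNIV (cdot (u i))" for i
    unfolding cdot_def by (intro continuous_intros)
  then have "closed C"
    unfolding C_def Ball_def by (intro closed_Collect_all closed_Collect_imp closed_Collect_eq) auto
  then have "compact (sphere 0 1 \<inter> C)"
    by (simp add: compact_Int_closed)
  moreover have "(1 / norm y) *\<^sub>R y \<in> sphere 0 1 \<inter> C"
    using C_lin(3) y(1) yC by simp
  moreover have "continuous_on (sphere 0 1 \<inter> C) f"
    unfolding f_def Re_cdot[symmetric] cdot_def matrix_vector_mult_def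
    by (intro continuous_intros)
  ultimately obtain x where x: "x \<in> sphere 0 1 \<inter> C" "\<And>z. z \<in> sphere 0 1 \<inter> C \<Longrightarrow> f z \<le> f x"
    by (metis continuous_attains_sup emptyE)
  define m where "m = f x"
  have xx: "x \<bullet> x = 1"
    using x(1) by (simp add: norm_eq_1)
  \<comment> \<open>The form of \<open>m - A\<close> is nonnegative on \<open>C\<close> and vanishes
    at the maximizer \<open>x\<close>, so its first variation at \<open>x\<close> must vanish along
    \<open>C\<close>.\<close>
  define Q where "Q z w = m * (z \<bullet> w) - z \<bullet> (A *v w)" for z w
  have Qpos: "0 \<le> Q z z" if "z \<in> C" for z
  proof (cases "z = 0")
    case False
    have "f ((1 / norm z) *\<^sub>R z) \<le> m"
      unfolding m_def using False C_lin(3)[OF that that] by (intro x(2)) auto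
    moreover have "A *v ((1 / norm z) *\<^sub>R z) = (1 / norm z) *\<^sub>R (A *v z)"
      by (rule linear_scale) (rule matrix_vector_mul_linear)
    ultimately have "f z / (norm z)\<^sup>2 \<le> m"
      by (simp add: f_def power2_eq_square)
    then show ?thesis
      using False by (simp add: Q_def f_def power2_norm_eq_inner[symmetric] divide_le_eq)
  qed (simp add: Q_def)
  define w where "w = m *\<^sub>R x - A *v x"
  have wC: "w \<in> C"
    unfolding w_def using x(1) C_lin CA by blast
  have Qxx: "Q x x = 0"
    by (simp add: Q_def m_def f_def xx)
  have Qwx: "Q w x = w \<bullet> w"
    by (simp add: Q_def w_def inner_diff_right)
  have "w \<bullet> w = 0"
  proof (rule ccontr)
    assume "w \<bullet> w \<noteq> 0"
    then have pos: "0 < w \<bullet> w" by simp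
    \<comment> \<open>This step length keeps the second-order term \<open>e\<^sup>2 * Q w w\<close>
      below \<open>e * (w \<bullet> w)\<close>, half of the first-order gain; the \<open>+ 1\<close>
      keeps the denominator positive.\<close>
    define e where "e = (w \<bullet> w) / (Q w w + 1)"
    have Qww: "0 \<le> Q w w" using Qpos wC by simp
    have e: "0 < e" using pos Qww by (simp add: e_def)
    have "0 \<le> Q (x - e *\<^sub>R w) (x - e *\<^sub>R w)"
      using x(1) wC by (intro Qpos C_lin) auto
    also have "\<dots> = Q x x - 2 * e * Q w x + e\<^sup>2 * Q w w"
    proof -
      have "A *v (x - e *\<^sub>R w) = A *v x - e *\<^sub>R (A *v w)"
        by (simp add: matrix_vector_mult_diff_distrib linear_scale[OF matrix_vector_mul_linear])
      then show ?thesis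
        unfolding Q_def using sym[of x w] inner_commute[of x w]
        by (simp only: inner_diff_left inner_diff_right inner_scaleR_left inner_scaleR_right)
          (simp add: algebra_simps power2_eq_square)
    qed
    also have "\<dots> = e * (e * Q w w - 2 * (w \<bullet> w))"
      by (simp add: Qxx Qwx algebra_simps power2_eq_square)
    finally have "2 * (w \<bullet> w) \<le> e * Q w w"
      using e by (simp add: zero_le_mult_iff)
    also have "e * Q w w \<le> w \<bullet> w"
      unfolding e_def using pos Qww by (simp add: field_simps)
    finally show False using pos by simp
  qed
  then have "A *v x = m *\<^sub>R x"
    by (simp add: w_def)
  also have "\<dots> = complex_of_real m *s x"
    by (simp add: vec_eq_iff scaleR_conv_of_real[where 'a = complex])
  finally have "A *v x = complex_of_real m *s x" .
  then show ?thesis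
    using x(1) that[of x m] by (auto simp: C_def)
qed

text \<open>Orthonormal eigenvectors are collected one index at a time, by induction on finite sets
  of indices; the full family supplies the columns of \<open>U\<close>.\<close>

theorem hermitian_diagonalization:
  fixes A :: "complex ^ 'n ^ 'n"
  assumes A: "hermitian_mat A"
  obtains U d where "unitary_mat U" "A = U ** diag_mat d ** adjoint_mat U"
proof -
  have "\<exists>u d. (\<forall>i\<in>S. \<forall>j\<in>S. cdot (u i) (u j) = (if i = j then 1 else 0)) \<and>
      (\<forall>i\<in>S. A *v u i = complex_of_real (d i) *s u i)" for S :: "'n set"
  proof (induction S rule: finite_induct[OF finite])
    case (2 k S)
    then obtain u d where u: "\<forall>i\<in>S. \<forall>j\<in>S. cdot (u i) (u j) = (if i = j then 1 else 0)"
      and d: "\<forall>i\<in>S. A *v u i = complex_of_real (d i) *s u i"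
      by blast
    have u1: "norm (u i) = 1" if "i \<in> S" for i
    proof -
      have "complex_of_real ((norm (u i))\<^sup>2) = of_real 1"
        using u that by (simp only: cdot_self[symmetric]) simp
      then show ?thesis
        by (simp only: of_real_eq_iff) (simp add: abs_square_eq_1)
    qed
    have "S \<noteq> UNIV" using 2 by blast
    then obtain x m where x: "norm x = 1" "\<And>i. i \<in> S \<Longrightarrow> cdot (u i) x = 0"
      "A *v x = complex_of_real m *s x"
      using hermitian_orthonormal_extend[OF A, of S u d] d by blast
    have x': "cdot x (u i) = 0" if "i \<in> S" for i
      using x(2)[OF that] cnj_cdot[of "u i" x] by simp
    show ?case
      using 2(2) u u1 d x x'
      by (intro exI[of _ "u(k := x)"] exI[of _ "d(k := m)"]) (auto simp: cdot_self)
  qed simp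
  from this[of UNIV] obtain u :: "'n \<Rightarrow> complex ^ 'n" and d
    where u: "\<And>i j. cdot (u i) (u j) = (if i = j then 1 else 0)"
      and d: "\<And>i. A *v u i = complex_of_real (d i) *s u i" by auto
  define U where "U = (\<chi> i j. u j $ i)"
  have "adjoint_mat U ** U = mat 1"
    using u by (simp add: vec_eq_iff matrix_matrix_mult_def adjoint_mat_def U_def mat_def cdot_def)
  then have U: "unitary_mat U"
    by (simp add: unitary_mat_def matrix_left_right_inverse)
  have "A ** U = U ** diag_mat d"
  proof (unfold vec_eq_iff, intro allI)
    fix i j
    show "(A ** U) $ i $ j = (U ** diag_mat d) $ i $ j"
      unfolding diag_mat_mult_nth using arg_cong[OF d[of j], of "\<lambda>v. v $ i"]
      by (simp add: U_def matrix_vector_mult_def matrix_matrix_mult_def mult.commute)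
  qed
  then have "A = U ** diag_mat d ** adjoint_mat U"
    using U by (metis matrix_mul_assoc matrix_mul_rid unitary_mat_def)
  with U that show ?thesis by blast
qed

lemma diag_mat_mult_vec_nth: "(diag_mat d *v x) $ i = d i * x $ i"
  by (simp add: matrix_vector_mult_def diag_mat_def if_distrib if_distribR cong: if_cong)

text \<open>The witness is column \<open>i\<close> of \<open>U\<close>. Evaluating the form there
  passes its sign on to the eigenvalues.\<close>

lemma eigenvalue_eq_cdot:
  fixes U :: "complex ^ 'n ^ 'n"
  assumes "unitary_mat U" and A: "A = U ** diag_mat d ** adjoint_mat U"
  obtains x where "x \<noteq> 0" "cdot x (A *v x) = of_real (d i)"
proof -
  have UU: "adjoint_mat U ** U = mat 1"
    using assms by (simp add: unitary_mat_def)
  define x where "x = U *v axis i 1"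
  have Ux: "adjoint_mat U *v x = axis i 1"
    by (simp add: x_def matrix_vector_mul_assoc UU)
  then have "x \<noteq> 0" by auto
  moreover have "cdot x (A *v x) = cdot (adjoint_mat U *v x) (diag_mat d *v (adjoint_mat U *v x))"
    by (simp only: A matrix_vector_mul_assoc[symmetric] cdot_adjoint[of x U])
  moreover have "diag_mat d *v axis i 1 = complex_of_real (d i) *s axis i 1"
    by (simp add: vec_eq_iff diag_mat_mult_vec_nth axis_def)
  ultimately show ?thesis
    using that[of x] by (simp add: Ux cdot_smult_right cdot_self)
qed

lemma hpd_diagonalization:
  fixes A :: "complex ^ 'n ^ 'n"
  assumes "hpd_mat A"
  obtains U d where "unitary_mat U" "\<And>i. 0 < d i" "A = U ** diag_mat d ** adjoint_mat U"
proof -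
  obtain U d where U: "unitary_mat U" and A: "A = U ** diag_mat d ** adjoint_mat U"
    using assms hermitian_diagonalization unfolding hpd_mat_def by blast
  have "0 < d i" for i
  proof -
    obtain x where "x \<noteq> 0" "cdot x (A *v x) = of_real (d i)"
      using eigenvalue_eq_cdot[OF U A] .
    then show ?thesis
      using assms by (auto simp: hpd_mat_def simp flip: cdot_def)
  qed
  with U A that show ?thesis by blast
qed

lemma cdot_gram: "cdot x ((adjoint_mat N ** N) *v x) = of_real ((norm (N *v x))\<^sup>2)"
  by (simp only: matrix_vector_mul_assoc[symmetric] cdot_adjoint adjoint_mat_adjoint cdot_self)

lemma hermitian_gram: "hermitian_mat (adjoint_mat N ** N)"
  by (simp add: hermitian_mat_def adjoint_mat_mult)

lemma hpd_gram:
  fixes N :: "complex ^ 'n ^ 'n"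
  assumes "invertible N"
  shows "hpd_mat (adjoint_mat N ** N)"
proof -
  have "N *v x \<noteq> 0" if "x \<noteq> 0" for x
    using assms that
    by (metis invertible_def matrix_vector_mul_assoc matrix_vector_mul_lid matrix_vector_mult_0_right)
  then show ?thesis
    by (simp add: hpd_mat_def hermitian_gram cdot_gram flip: cdot_def)
qed

section \<open>Cauchy-Schwarz inequalities for determinants\<close>

lemma unitary_mult_cancel:
  assumes "unitary_mat U"
  shows "U ** M ** adjoint_mat U ** (U ** N ** adjoint_mat U) = U ** (M ** N) ** adjoint_mat U"
  using assms unfolding unitary_mat_def by (metis matrix_mul_assoc matrix_mul_rid)

lemma diag_mat_one: "diag_mat (\<lambda>i. 1) = mat 1"
  by (simp add: vec_eq_iff diag_mat_def mat_def)

lemma diag_mat_mult: "diag_mat d ** diag_mat e = diag_mat (\<lambda>i. d i * e i)"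
  by (simp add: vec_eq_iff diag_mat_mult_nth) (simp add: diag_mat_def)

lemma one_plus_diagonalized:
  assumes "unitary_mat U"
  shows "mat 1 + U ** diag_mat d ** adjoint_mat U = U ** diag_mat (\<lambda>i. 1 + d i) ** adjoint_mat U"
proof -
  have "diag_mat (\<lambda>i. 1 + d i) = mat 1 + diag_mat d"
    by (simp add: vec_eq_iff diag_mat_def mat_def)
  then show ?thesis
    using assms by (simp add: matrix_add_ldistrib matrix_add_rdistrib unitary_mat_def)
qed

lemma det_diagonalized:
  assumes "unitary_mat U"
  shows "det (U ** diag_mat d ** adjoint_mat U) = of_real (\<Prod>i\<in>UNIV. d i)"
proof -
  have "det (U ** diag_mat d ** adjoint_mat U) = det (diag_mat d :: complex ^ 'a ^ 'a)"
    using assms by (intro det_similar) (simp add: unitary_mat_def)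
  also have "\<dots> = (\<Prod>i\<in>UNIV. diag_mat d $ i $ i)"
    by (rule det_diagonal) (simp add: diag_mat_def)
  finally show ?thesis
    by (simp add: diag_mat_def)
qed

lemma invertible_adjoint:
  fixes A :: "complex ^ 'n ^ 'n"
  shows "invertible A \<Longrightarrow> invertible (adjoint_mat A)"
  by (simp add: invertible_det_nz det_adjoint_mat)

lemma gram_diagonalization:
  fixes T :: "complex ^ 'n ^ 'n"
  obtains U d where "unitary_mat U" "\<And>i. 0 \<le> d i"
    "adjoint_mat T ** T = U ** diag_mat d ** adjoint_mat U"
proof -
  obtain U d where U: "unitary_mat U" and A: "adjoint_mat T ** T = U ** diag_mat d ** adjoint_mat U"
    using hermitian_gram hermitian_diagonalization by blast
  have "0 \<le> d i" for i
  proof -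
    obtain x where "cdot x ((adjoint_mat T ** T) *v x) = of_real (d i)"
      using eigenvalue_eq_cdot[OF U A] .
    then have "d i = (norm (T *v x))\<^sup>2"
      unfolding cdot_gram by (simp only: of_real_eq_iff)
    then show ?thesis by simp
  qed
  with U A that show ?thesis by blast
qed

lemma det_one_plus_gram:
  fixes T :: "complex ^ 'n ^ 'n"
  obtains r where "1 \<le> r" "det (mat 1 + adjoint_mat T ** T) = of_real r"
proof -
  obtain U d where U: "unitary_mat U" "\<And>i. 0 \<le> d i"
    "adjoint_mat T ** T = U ** diag_mat d ** adjoint_mat U"
    using gram_diagonalization[of T] by blast
  have "det (mat 1 + adjoint_mat T ** T) = of_real (\<Prod>i\<in>UNIV. 1 + d i)"
    by (simp only: U(3) one_plus_diagonalized[OF U(1)] det_diagonalized[OF U(1)])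
  moreover have "1 \<le> (\<Prod>i\<in>UNIV. 1 + d i)"
    by (rule prod_ge_1) (simp add: U(2))
  ultimately show ?thesis using that by blast
qed

text \<open>\<open>Z\<close> is the inverse square root of
  \<open>mat 1 + adjoint_mat T ** T\<close>. Having the inverse in factored form turns the summands
  of the splitting below into products of a matrix with its adjoint.\<close>

lemma inverse_one_plus_gram:
  fixes T :: "complex ^ 'n ^ 'n"
  obtains Z :: "complex ^ 'n ^ 'n" where "Z ** adjoint_mat Z ** (mat 1 + adjoint_mat T ** T) = mat 1"
proof -
  obtain U d where U: "unitary_mat U" "\<And>i. 0 \<le> d i"
    "adjoint_mat T ** T = U ** diag_mat d ** adjoint_mat U"
    using gram_diagonalization[of T] by blast
  define Z where "Z = U ** diag_mat (\<lambda>i. 1 / sqrt (1 + d i)) ** adjoint_mat U"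
  have Z': "adjoint_mat Z = Z"
    by (simp add: Z_def adjoint_mat_mult matrix_mul_assoc)
  have d: "1 / sqrt (1 + d i) * (1 / sqrt (1 + d i)) * (1 + d i) = 1" for i
    using U(2)[of i] by (simp add: field_simps)
  have "Z ** adjoint_mat Z ** (mat 1 + adjoint_mat T ** T)
      = U ** diag_mat (\<lambda>i. 1 / sqrt (1 + d i) * (1 / sqrt (1 + d i)) * (1 + d i)) ** adjoint_mat U"
    unfolding Z'
    unfolding Z_def U(3) one_plus_diagonalized[OF U(1)] unitary_mult_cancel[OF U(1)] diag_mat_mult ..
  also have "\<dots> = mat 1"
    unfolding d using U(1) by (simp add: diag_mat_one unitary_mat_def)
  finally show ?thesis
    by (rule that)
qed

text \<open>The right-hand side splits \<open>X\<^sup>* X\<close>, \<open>X = (1, S)\<close>, along the range of \<open>(1, T)\<close> and its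
  orthogonal complement, the range of \<open>(- T\<^sup>*, 1)\<close>.\<close>

lemma one_plus_gram_split:
  fixes S T :: "complex ^ 'n ^ 'n"
  assumes E: "E ** (mat 1 + adjoint_mat T ** T) = mat 1"
    and F: "F ** (mat 1 + T ** adjoint_mat T) = mat 1"
  shows "mat 1 + adjoint_mat S ** S
       = (mat 1 + adjoint_mat S ** T) ** E ** (mat 1 + adjoint_mat T ** S)
       + (adjoint_mat S - adjoint_mat T) ** F ** (S - T)"
proof -
  define X Y where "X = adjoint_mat S" and "Y = adjoint_mat T"
  note dist = matrix_add_ldistrib matrix_add_rdistrib matrix_diff_ldistrib matrix_diff_rdistrib
  have E1: "E + E ** Y ** T = mat 1"
    using E by (simp add: Y_def dist matrix_mul_assoc)
  have E2: "(mat 1 + Y ** T) ** E = mat 1" and F2: "(mat 1 + T ** Y) ** F = mat 1"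
    using E F by (simp_all add: Y_def matrix_left_right_inverse)
  have F1: "F + F ** T ** Y = mat 1"
    using F by (simp add: Y_def dist matrix_mul_assoc)
  \<comment> \<open>Push-through identity: \<open>T\<close> intertwines
    \<open>mat 1 + Y ** T\<close> with \<open>mat 1 + T ** Y\<close>, hence also their inverses
    \<open>E\<close> and \<open>F\<close>. The same argument with \<open>Y\<close> gives
    \<open>EY\<close>.\<close>
  have "F ** T = F ** (T ** (mat 1 + Y ** T)) ** E"
    using E2 by (metis matrix_mul_assoc matrix_mul_rid)
  also have "T ** (mat 1 + Y ** T) = (mat 1 + T ** Y) ** T"
    by (simp add: dist matrix_mul_assoc)
  also have "F ** \<dots> ** E = T ** E"
    using F by (simp add: Y_def matrix_mul_assoc)
  finally have TE: "T ** E = F ** T" ..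
  have "E ** Y = E ** (Y ** (mat 1 + T ** Y)) ** F"
    using F2 by (metis matrix_mul_assoc matrix_mul_rid)
  also have "Y ** (mat 1 + T ** Y) = (mat 1 + Y ** T) ** Y"
    by (simp add: dist matrix_mul_assoc)
  also have "E ** \<dots> ** F = Y ** F"
    using E by (simp add: Y_def matrix_mul_assoc)
  finally have EY: "E ** Y = Y ** F" .
  \<comment> \<open>After expansion the first two brackets equal \<open>mat 1\<close> by
    \<open>E1\<close> and \<open>F1\<close>, and the last two vanish by the push-through
    identities.\<close>
  have "(mat 1 + X ** T) ** E ** (mat 1 + Y ** S) + (X - Y) ** F ** (S - T)
      = (E + Y ** F ** T) + X ** (F + T ** E ** Y) ** S
      + (E ** Y ** S - Y ** F ** S) + (X ** (T ** E) - X ** (F ** T))"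
    by (simp add: dist matrix_mul_assoc)
  also have "\<dots> = mat 1 + X ** S"
    using E1 F1 by (simp add: TE EY[symmetric])
  finally show ?thesis
    by (simp add: X_def Y_def)
qed

text \<open>By the splitting, \<open>mat 1 + adjoint_mat S ** S\<close> equals
  \<open>R ** (mat 1 + N ** adjoint_mat N) ** adjoint_mat R\<close>, and the determinant of the
  middle factor is at least 1. So \<open>s\<close> is at least the squared modulus of
  \<open>det R\<close>, which is that of \<open>det W\<close> divided by \<open>t\<close>.\<close>

theorem det_one_plus_Cauchy_Schwarz:
  fixes S T :: "complex ^ 'n ^ 'n"
  shows "(cmod (det (mat 1 + adjoint_mat S ** T)))\<^sup>2
       \<le> Re (det (mat 1 + adjoint_mat S ** S)) * Re (det (mat 1 + adjoint_mat T ** T))"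
proof -
  define W where "W = mat 1 + adjoint_mat S ** T"
  obtain s where s: "1 \<le> s" "det (mat 1 + adjoint_mat S ** S) = of_real s"
    using det_one_plus_gram[of S] by blast
  obtain t where t: "1 \<le> t" "det (mat 1 + adjoint_mat T ** T) = of_real t"
    using det_one_plus_gram[of T] by blast
  have "(cmod (det W))\<^sup>2 \<le> s * t"
  proof (cases "det W = 0")
    case True
    then show ?thesis using s t by simp
  next
    case False
    obtain Z :: "complex ^ 'n ^ 'n" where Z: "Z ** adjoint_mat Z ** (mat 1 + adjoint_mat T ** T) = mat 1"
      using inverse_one_plus_gram[of T] .
    obtain Z' :: "complex ^ 'n ^ 'n" where Z': "Z' ** adjoint_mat Z' ** (mat 1 + T ** adjoint_mat T) = mat 1"
      using inverse_one_plus_gram[of "adjoint_mat T", unfolded adjoint_mat_adjoint] .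
    define R where "R = W ** Z"
    have "det Z * cnj (det Z) * of_real t = 1"
      using arg_cong[OF Z, of det] by (simp add: det_mul det_adjoint_mat t)
    then have "complex_of_real ((cmod (det Z))\<^sup>2 * t) = of_real 1"
      unfolding of_real_mult complex_norm_square by simp
    then have Zt: "(cmod (det Z))\<^sup>2 * t = 1"
      by (simp only: of_real_eq_iff)
    then have "det R \<noteq> 0"
      using False by (auto simp: R_def det_mul)
    then obtain R' where R': "R ** R' = mat 1"
      using invertible_det_nz[of R] by (auto simp: invertible_def)
    \<comment> \<open>Dividing by \<open>R\<close> on the left lets \<open>R\<close> be pulled out
      of both summands of the splitting; \<open>R\<close> is invertible because \<open>det W\<close>
      is nonzero in this case.\<close>
    define N where "N = R' ** (adjoint_mat S - adjoint_mat T) ** Z'"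
    have RN: "R ** N = (adjoint_mat S - adjoint_mat T) ** Z'"
      by (simp add: N_def matrix_mul_assoc R')
    have "mat 1 + adjoint_mat S ** S = R ** adjoint_mat R + (R ** N) ** adjoint_mat (R ** N)"
      unfolding one_plus_gram_split[OF Z Z'] RN
      by (simp add: R_def W_def adjoint_mat_mult adjoint_mat_add adjoint_mat_diff matrix_mul_assoc)
    also have "\<dots> = R ** (mat 1 + adjoint_mat (adjoint_mat N) ** adjoint_mat N) ** adjoint_mat R"
      by (simp add: adjoint_mat_mult matrix_add_ldistrib matrix_add_rdistrib matrix_mul_assoc)
    finally have *: "mat 1 + adjoint_mat S ** S = \<dots>" .
    obtain c where c: "1 \<le> c"
      "det (mat 1 + adjoint_mat (adjoint_mat N) ** adjoint_mat N) = of_real c"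
      using det_one_plus_gram[of "adjoint_mat N"] by blast
    have "complex_of_real s = of_real ((cmod (det R))\<^sup>2 * c)"
      using arg_cong[OF *, of det] unfolding s(2)
      by (simp add: det_mul det_adjoint_mat c(2) complex_norm_square mult_ac
          del: adjoint_mat_adjoint of_real_power)
    then have "s = (cmod (det R))\<^sup>2 * c"
      by (simp only: of_real_eq_iff)
    then have "(cmod (det R))\<^sup>2 \<le> s"
      using c(1) by (simp add: mult_le_cancel_left1)
    then have "(cmod (det R))\<^sup>2 * t \<le> s * t"
      using t(1) by (intro mult_right_mono) auto
    moreover have "(cmod (det R))\<^sup>2 * t = (cmod (det W))\<^sup>2 * ((cmod (det Z))\<^sup>2 * t)"
      by (simp add: R_def det_mul norm_mult power_mult_distrib)
    ultimately show ?thesis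
      by (simp add: Zt)
  qed
  then show ?thesis
    by (simp add: W_def s t)
qed

section \<open>Powers with exponent \<open>2 ^ j\<close>, obtained by repeated squaring\<close>

definition sq_iter :: "nat \<Rightarrow> 'a::semiring_1 ^ 'n ^ 'n \<Rightarrow> 'a ^ 'n ^ 'n" where
  "sq_iter j = ((\<lambda>M. M ** M) ^^ j)"

lemma sq_iter_0 [simp]: "sq_iter 0 M = M"
  by (simp add: sq_iter_def)

lemma sq_iter_Suc: "sq_iter (Suc j) M = sq_iter j (M ** M)"
  by (simp only: sq_iter_def funpow_Suc_right o_apply)

lemma sq_iter_Suc': "sq_iter (Suc j) M = sq_iter j M ** sq_iter j M"
  by (simp add: sq_iter_def)

lemma sq_iter_similar:
  assumes "Y ** X = mat 1"
  shows "sq_iter j (X ** M ** Y) = X ** sq_iter j M ** Y"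
proof (induction j)
  case (Suc j)
  have "X ** sq_iter j M ** Y ** (X ** sq_iter j M ** Y)
      = X ** sq_iter j M ** (Y ** X) ** sq_iter j M ** Y"
    by (simp only: matrix_mul_assoc)
  then show ?case
    by (simp add: sq_iter_Suc' Suc assms matrix_mul_assoc)
qed simp

text \<open>Conjugation by \<open>X\<close> carries \<open>Y ** X\<close> to \<open>X ** Y\<close>,
  commutes with squaring and preserves determinants.\<close>

lemma det_one_plus_sq_iter_cyclic:
  fixes X Y :: "complex ^ 'n ^ 'n"
  assumes "invertible X"
  shows "det (mat 1 + sq_iter j (X ** Y)) = det (mat 1 + sq_iter j (Y ** X))"
proof -
  obtain X' where X': "X ** X' = mat 1" "X' ** X = mat 1"
    using assms by (auto simp: invertible_def)
  have "X ** Y = X ** (Y ** X) ** X'"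
    using X'(1) by (metis matrix_mul_assoc matrix_mul_rid)
  then have "mat 1 + sq_iter j (X ** Y) = X ** (mat 1 + sq_iter j (Y ** X)) ** X'"
    using X' sq_iter_similar[of X' X j "Y ** X"] by (simp add: matrix_add_ldistrib matrix_add_rdistrib)
  then show ?thesis
    using det_similar[OF X'(1)] by simp
qed

text \<open>A Hoelder inequality for \<open>M \<mapsto> det (1 + M)\<close> in the style of the chessboard estimate: as for
  the trace, only the Cauchy-Schwarz inequality and cyclicity are used.\<close>

theorem det_one_plus_sq_iter_Cauchy_Schwarz:
  fixes S T :: "complex ^ 'n ^ 'n"
  assumes "invertible S" "invertible T"
  shows "(cmod (det (mat 1 + sq_iter j (adjoint_mat S ** T))))\<^sup>2
       \<le> Re (det (mat 1 + sq_iter j (adjoint_mat S ** S)))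
       * Re (det (mat 1 + sq_iter j (adjoint_mat T ** T)))"
  using assms
proof (induction j arbitrary: S T)
  case 0
  then show ?case
    by (simp add: det_one_plus_Cauchy_Schwarz)
next
  case (Suc j)
  define D where "D M = det (mat 1 + sq_iter j M)" for M :: "complex ^ 'n ^ 'n"
  define M where "M = adjoint_mat S ** T"
  note inv = Suc.prems invertible_adjoint invertible_mult
  have cyc: "D (X ** Y) = D (Y ** X)" if "invertible X" for X Y
    using det_one_plus_sq_iter_cyclic[OF that] by (simp add: D_def)
  have M: "invertible M"
    unfolding M_def by (intro inv)
  \<comment> \<open>Cyclicity regroups the four factors into a product of two Hermitian matrices,
    one built from \<open>S\<close> and one from \<open>T\<close>, to which the induction hypothesis
    applies again.\<close>
  have "D (adjoint_mat M ** M) = D (adjoint_mat T ** (S ** adjoint_mat S ** T))"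
    by (simp add: M_def adjoint_mat_mult matrix_mul_assoc)
  also have "\<dots> = D (S ** adjoint_mat S ** T ** adjoint_mat T)"
    by (intro cyc inv)
  finally have MM: "D (adjoint_mat M ** M) = D (adjoint_mat (S ** adjoint_mat S) ** (T ** adjoint_mat T))"
    by (simp add: adjoint_mat_mult matrix_mul_assoc)
  have square: "D (X ** adjoint_mat X ** (X ** adjoint_mat X)) = D (adjoint_mat X ** X ** (adjoint_mat X ** X))"
    if "invertible X" for X
    using cyc[OF that, of "adjoint_mat X ** X ** adjoint_mat X"] by (simp add: matrix_mul_assoc)
  \<comment> \<open>First use of the induction hypothesis, for the pair
    \<open>adjoint_mat M\<close>, \<open>M\<close>: one more squaring of
    \<open>adjoint_mat S ** T\<close> means starting from \<open>M ** M\<close>.\<close>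
  have "(cmod (D (M ** M)))\<^sup>2 \<le> Re (D (M ** adjoint_mat M)) * Re (D (adjoint_mat M ** M))"
    using Suc.IH[OF invertible_adjoint[OF M] M] by (simp add: D_def)
  also have "\<dots> = (Re (D (adjoint_mat M ** M)))\<^sup>2"
    using cyc[OF M] by (simp add: power2_eq_square)
  also have "\<dots> \<le> (cmod (D (adjoint_mat M ** M)))\<^sup>2"
    using abs_Re_le_cmod by (metis abs_ge_zero power2_abs power_mono)
  \<comment> \<open>Second use of the induction hypothesis, which separates \<open>S\<close> from
    \<open>T\<close>.\<close>
  also have "\<dots> \<le> Re (D (S ** adjoint_mat S ** (S ** adjoint_mat S)))
      * Re (D (T ** adjoint_mat T ** (T ** adjoint_mat T)))"
    unfolding MM using Suc.IH[of "S ** adjoint_mat S" "T ** adjoint_mat T"] Suc.prems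
    by (simp add: D_def adjoint_mat_mult invertible_adjoint invertible_mult)
  finally show ?case
    unfolding square[OF Suc.prems(1)] square[OF Suc.prems(2)]
    by (simp add: D_def M_def sq_iter_Suc)
qed

section \<open>Monotonicity along powers\<close>

text \<open>After subtraction of the chord, a maximum point \<open>z\<close> is the midpoint of an
  endpoint, where \<open>g\<close> vanishes, and another point of the interval. Hence
  \<open>g z \<le> g z / 2\<close>, so the maximum is at most 0.\<close>

lemma midpoint_convex_le_chord:
  fixes f :: "real \<Rightarrow> real"
  assumes cont: "continuous_on {0..r} f" and r: "0 < r" and s: "0 \<le> s" "s \<le> r"
    and mid: "\<And>x y. f ((x + y) / 2) \<le> (f x + f y) / 2"
  shows "f s \<le> s / r * f r + (1 - s / r) * f 0"
proof -
  define k where "k = (f r - f 0) / r"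
  define g where "g x = f x - (f 0 + k * x)" for x
  have g_ends: "g 0 = 0" "g r = 0"
    using r by (simp_all add: g_def k_def)
  have g_mid: "g ((x + y) / 2) \<le> (g x + g y) / 2" for x y
    using mid[of x y] by (simp add: g_def field_simps)
  have "continuous_on {0..r} g"
    unfolding g_def by (intro continuous_intros cont)
  then obtain z where z: "z \<in> {0..r}" "\<And>x. x \<in> {0..r} \<Longrightarrow> g x \<le> g z"
    using continuous_attains_sup[of "{0..r}" g] r by auto
  have "g z \<le> 0"
  proof (cases "z \<le> r / 2")
    case True
    then show ?thesis
      using g_mid[of 0 "2 * z"] z(2)[of "2 * z"] z(1) g_ends by simp
  next
    case False
    then show ?thesis
      using g_mid[of r "2 * z - r"] z(2)[of "2 * z - r"] z(1) g_ends by simp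
  qed
  then have "g s \<le> 0"
    using z(2)[of s] s by simp
  then have "f s \<le> f 0 + k * s"
    by (simp add: g_def)
  also have "\<dots> = s / r * f r + (1 - s / r) * f 0"
    using r by (simp add: k_def field_simps)
  finally show ?thesis .
qed

section \<open>One-parameter groups of Hermitian matrices, modelling real powers of \<open>A\<close>
  and \<open>B\<close>\<close>

definition hermitian_group :: "(real \<Rightarrow> complex ^ 'n ^ 'n) \<Rightarrow> bool" where
  "hermitian_group P \<longleftrightarrow> continuous_on UNIV P \<and> P 0 = mat 1 \<and>
     (\<forall>s r. P s ** P r = P (s + r)) \<and> (\<forall>s. adjoint_mat (P s) = P s)"

lemma hermitian_groupD:
  assumes "hermitian_group P"
  shows "continuous_on S P" "P 0 = mat 1" "P s ** P r = P (s + r)" "adjoint_mat (P s) = P s"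
    "invertible (P s)"
  using assms unfolding hermitian_group_def invertible_def
  by (auto intro: continuous_on_subset exI[of _ "P (- s)"])

text \<open>Provides the negative powers of \<open>B\<close>; applied to both groups it replaces
  \<open>K s\<close> by its inverse.\<close>

lemma hermitian_group_minus: "hermitian_group P \<Longrightarrow> hermitian_group (\<lambda>s. P (- s))"
  unfolding hermitian_group_def
  by (auto intro!: continuous_on_compose2[of UNIV P] continuous_intros)

lemma hermitian_group_scale:
  assumes "hermitian_group P"
  shows "hermitian_group (\<lambda>s. exp (c * s) *\<^sub>R P s)"
  using assms unfolding hermitian_group_def
  by (auto intro!: continuous_intros simp: scaleR_matrix_mult_left scaleR_matrix_mult_right
      exp_add[symmetric] algebra_simps adjoint_mat_def vec_eq_iff)

lemma mat_powr_diagonalized: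
  assumes "unitary_mat U"
  shows "mat_powr (U ** diag_mat d ** adjoint_mat U) s
       = U ** diag_mat (\<lambda>i. d i powr s) ** adjoint_mat U"
  unfolding mat_powr_def by (rule mat_fun_diag[OF assms])

lemma hermitian_group_mat_powr:
  assumes "hpd_mat A"
  shows "hermitian_group (mat_powr A)"
proof -
  obtain U d where U: "unitary_mat U" and d: "\<And>i. 0 < d i"
    and A: "A = U ** diag_mat d ** adjoint_mat U"
    using hpd_diagonalization[OF assms] by blast
  note powr = mat_powr_diagonalized[OF U, of d, folded A]
  have "continuous_on UNIV (\<lambda>s. diag_mat (\<lambda>i. d i powr s) :: complex ^ 'a ^ 'a)"
    unfolding diag_mat_def
  proof (intro continuous_intros)
    fix i j
    show "continuous_on UNIV (\<lambda>s. if i = j then complex_of_real (d i powr s) else 0)"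
      using d[of i] by (cases "i = j") (auto intro!: continuous_intros)
  qed
  then have "continuous_on UNIV (mat_powr A)"
    unfolding powr by (intro continuous_intros)
  moreover have "mat_powr A 0 = mat 1"
    using U d by (simp add: powr diag_mat_one unitary_mat_def less_imp_neq[THEN not_sym])
  moreover have "mat_powr A s ** mat_powr A r = mat_powr A (s + r)" for s r
    by (simp add: powr unitary_mult_cancel[OF U] diag_mat_mult powr_add)
  moreover have "adjoint_mat (mat_powr A s) = mat_powr A s" for s
    by (simp add: powr adjoint_mat_mult matrix_mul_assoc)
  ultimately show ?thesis
    by (simp add: hermitian_group_def)
qed

lemma mat_powr_mat_powr:
  assumes "hpd_mat A"
  shows "mat_powr (mat_powr A s) r = mat_powr A (s * r)"
proof -
  obtain U d where U: "unitary_mat U" and A: "A = U ** diag_mat d ** adjoint_mat U"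
    using hpd_diagonalization[OF assms] by blast
  show ?thesis
    by (simp add: A mat_powr_diagonalized[OF U] powr_powr)
qed

section \<open>The matrices \<open>K s\<close> and the log-convexity of their determinants\<close>

definition sandwich :: "(real \<Rightarrow> complex ^ 'n ^ 'n) \<Rightarrow> (real \<Rightarrow> complex ^ 'n ^ 'n) \<Rightarrow> real \<Rightarrow> complex ^ 'n ^ 'n"
  where "sandwich P Q s = Q (s / 2) ** P s ** Q (s / 2)"

text \<open>Halving \<open>P s\<close> exhibits a Gram matrix of an invertible factor. This yields
  positive definiteness and the shape required by the Cauchy-Schwarz inequality.\<close>

lemma sandwich_gram:
  assumes "hermitian_group P" "hermitian_group Q"
  shows "sandwich P Q s = adjoint_mat (P (s / 2) ** Q (s / 2)) ** (P (s / 2) ** Q (s / 2))"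
proof -
  have "P (s / 2) ** P (s / 2) = P s"
    using assms by (simp add: hermitian_groupD)
  then show ?thesis
    using assms by (metis sandwich_def adjoint_mat_mult hermitian_groupD(4) matrix_mul_assoc)
qed

lemma hpd_sandwich:
  assumes "hermitian_group P" "hermitian_group Q"
  shows "hpd_mat (sandwich P Q s)"
  unfolding sandwich_gram[OF assms]
  using assms by (intro hpd_gram invertible_mult hermitian_groupD(5))

text \<open>For Hermitian groups the determinant is a product of positive reals, so
  \<open>Re\<close> only changes the type.\<close>

definition sandwich_det :: "nat \<Rightarrow> (real \<Rightarrow> complex ^ 'n ^ 'n) \<Rightarrow> (real \<Rightarrow> complex ^ 'n ^ 'n) \<Rightarrow> real \<Rightarrow> real"
  where "sandwich_det j P Q s = Re (det (mat 1 + sq_iter j (sandwich P Q s)))"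

lemma continuous_on_sq_iter:
  fixes f :: "real \<Rightarrow> complex ^ 'n ^ 'n"
  shows "continuous_on S f \<Longrightarrow> continuous_on S (\<lambda>x. sq_iter j (f x))"
  by (induction j) (auto simp: sq_iter_Suc' intro!: continuous_intros)

lemma continuous_on_sandwich_det:
  assumes "hermitian_group P" "hermitian_group Q"
  shows "continuous_on S (sandwich_det j P Q)"
proof -
  have half: "continuous_on S (\<lambda>s. Q (s / 2))"
    by (rule continuous_on_compose2[OF hermitian_groupD(1)[OF assms(2), of UNIV]])
      (auto intro!: continuous_intros)
  show ?thesis
    unfolding sandwich_det_def sandwich_def
    by (intro continuous_intros continuous_on_sq_iter half hermitian_groupD(1) assms)
qed

lemma sq_iter_diagonalized:
  assumes "unitary_mat U"
  shows "sq_iter j (U ** diag_mat d ** adjoint_mat U)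
       = U ** diag_mat (\<lambda>i. d i ^ 2 ^ j) ** adjoint_mat U"
  by (induction j)
    (simp_all add: sq_iter_Suc' unitary_mult_cancel[OF assms] diag_mat_mult mult_2 power_add)

lemma sandwich_det_diagonalized:
  assumes "unitary_mat U" "sandwich P Q s = U ** diag_mat l ** adjoint_mat U"
  shows "sandwich_det j P Q s = (\<Prod>i\<in>UNIV. 1 + l i ^ 2 ^ j)"
  by (simp only: sandwich_det_def assms(2) sq_iter_diagonalized[OF assms(1)]
      one_plus_diagonalized[OF assms(1)] det_diagonalized[OF assms(1)] Re_complex_of_real)

lemma sandwich_det_pos:
  assumes "hermitian_group P" "hermitian_group Q"
  shows "0 < sandwich_det j P Q s"
proof -
  obtain U d where U: "unitary_mat U" and d: "\<And>i. 0 < d i"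
    and K: "sandwich P Q s = U ** diag_mat d ** adjoint_mat U"
    using hpd_diagonalization[OF hpd_sandwich[OF assms]] by blast
  show ?thesis
    unfolding sandwich_det_diagonalized[OF U K] using d
    by (intro prod_pos) (simp add: add_pos_pos)
qed

text \<open>The Gram factors at \<open>s\<close> and \<open>r\<close> have a mixed product that
  cyclicity identifies, inside the determinant, with \<open>sandwich\<close> at the midpoint; the
  iterated Cauchy-Schwarz inequality then applies.\<close>

lemma sandwich_det_midpoint:
  fixes P Q :: "real \<Rightarrow> complex ^ 'n ^ 'n"
  assumes P: "hermitian_group P" and Q: "hermitian_group Q"
  shows "(sandwich_det j P Q ((s + r) / 2))\<^sup>2 \<le> sandwich_det j P Q s * sandwich_det j P Q r"
proof -
  define m where "m = (s + r) / 2"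
  define D where "D M = det (mat 1 + sq_iter j M)" for M :: "complex ^ 'n ^ 'n"
  define N where "N s = P (s / 2) ** Q (s / 2)" for s
  have inv: "invertible (N s)" for s
    unfolding N_def by (intro invertible_mult hermitian_groupD(5) P Q)
  have cyc: "D (Q a ** Y) = D (Y ** Q a)" for a Y
    unfolding D_def by (rule det_one_plus_sq_iter_cyclic[OF hermitian_groupD(5)[OF Q]])
  have "adjoint_mat (N s) ** N r = Q (s / 2) ** (P (s / 2) ** P (r / 2)) ** Q (r / 2)"
    by (simp add: N_def adjoint_mat_mult hermitian_groupD(4)[OF P] hermitian_groupD(4)[OF Q]
        matrix_mul_assoc)
  also have "P (s / 2) ** P (r / 2) = P m"
    by (simp add: hermitian_groupD(3)[OF P] m_def add_divide_distrib)
  finally have "D (adjoint_mat (N s) ** N r) = D (Q (s / 2) ** (P m ** Q (r / 2)))"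
    by (simp add: matrix_mul_assoc)
  also have "\<dots> = D (P m ** (Q (r / 2) ** Q (s / 2)))"
    using cyc[of "s / 2" "P m ** Q (r / 2)"] by (simp add: matrix_mul_assoc)
  \<comment> \<open>Only the sum of the two parameters matters, so \<open>Q m\<close> may be
    redistributed into equal halves around \<open>P m\<close>.\<close>
  also have "Q (r / 2) ** Q (s / 2) = Q (m / 2) ** Q (m / 2)"
    by (simp add: hermitian_groupD(3)[OF Q] m_def add_divide_distrib add.commute)
  also have "D (P m ** \<dots>) = D (sandwich P Q m)"
    using cyc[of "m / 2" "P m ** Q (m / 2)"] by (simp add: sandwich_def matrix_mul_assoc)
  finally have "D (sandwich P Q m) = D (adjoint_mat (N s) ** N r)" ..
  then have "(cmod (D (sandwich P Q m)))\<^sup>2 \<le> sandwich_det j P Q s * sandwich_det j P Q r"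
    using det_one_plus_sq_iter_Cauchy_Schwarz[OF inv[of s] inv[of r], of j]
    by (simp add: D_def sandwich_det_def sandwich_gram[OF P Q] N_def)
  moreover have "(sandwich_det j P Q m)\<^sup>2 \<le> (cmod (D (sandwich P Q m)))\<^sup>2"
    unfolding sandwich_det_def D_def using abs_Re_le_cmod
    by (metis abs_ge_zero power2_abs power_mono)
  ultimately show ?thesis
    by (simp add: m_def)
qed

lemma sandwich_det_0:
  fixes P Q :: "real \<Rightarrow> complex ^ 'n ^ 'n"
  assumes "hermitian_group P" "hermitian_group Q"
  shows "sandwich_det j P Q 0 = 2 ^ CARD('n)"
proof -
  have "unitary_mat (mat 1 :: complex ^ 'n ^ 'n)"
    by (simp add: unitary_mat_def)
  moreover have "sandwich P Q 0 = mat 1 ** diag_mat (\<lambda>i. 1) ** adjoint_mat (mat 1)"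
    using assms by (simp add: sandwich_def hermitian_groupD(2) diag_mat_one)
  ultimately show ?thesis
    using sandwich_det_diagonalized[of "mat 1 :: complex ^ 'n ^ 'n" P Q 0 "\<lambda>i. 1" j] by simp
qed

text \<open>Under \<open>ln\<close> the midpoint inequality becomes midpoint convexity. The constant
  is the value at 0, where \<open>sandwich\<close> is the identity.\<close>

lemma ln_sandwich_det_le_chord:
  fixes P Q :: "real \<Rightarrow> complex ^ 'n ^ 'n"
  assumes PQ: "hermitian_group P" "hermitian_group Q" and "0 < r" "0 \<le> s" "s \<le> r"
  shows "ln (sandwich_det j P Q s)
       \<le> s / r * ln (sandwich_det j P Q r) + (1 - s / r) * (CARD('n) * ln 2)"
proof -
  define f where "f s = ln (sandwich_det j P Q s)" for s
  note pos = sandwich_det_pos[OF PQ, of j]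
  have "f ((x + y) / 2) \<le> (f x + f y) / 2" for x y
  proof -
    have "ln ((sandwich_det j P Q ((x + y) / 2))\<^sup>2) \<le> ln (sandwich_det j P Q x * sandwich_det j P Q y)"
      using sandwich_det_midpoint[OF PQ, of j x y]
      by (intro ln_mono) (simp_all add: pos less_imp_neq[OF pos, THEN not_sym])
    then show ?thesis
      using pos by (simp add: f_def ln_mult_pos ln_realpow)
  qed
  moreover have "continuous_on {0..r} f"
    unfolding f_def
    by (intro continuous_on_ln continuous_on_sandwich_det PQ ballI less_imp_neq[THEN not_sym] pos)
  ultimately have "f s \<le> s / r * f r + (1 - s / r) * f 0"
    using assms by (intro midpoint_convex_le_chord) auto
  then show ?thesis
    by (simp add: f_def sandwich_det_0[OF PQ] ln_realpow)
qed

section \<open>Hinge functions as limits of logarithms of determinants\<close>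

lemma ln_one_plus_power_bounds:
  fixes l :: real
  assumes "0 < l"
  shows "real n * max 0 (ln l) \<le> ln (1 + l ^ n)"
    and "ln (1 + l ^ n) \<le> real n * max 0 (ln l) + ln 2"
proof -
  have pow: "ln (l ^ n) = real n * ln l"
    using assms by (simp add: ln_realpow)
  have "ln (l ^ n) \<le> ln (1 + l ^ n)"
    using assms by (subst ln_le_cancel_iff) (auto simp: add_pos_pos)
  moreover have "0 \<le> ln (1 + l ^ n)"
    using assms by (intro ln_ge_zero) simp
  ultimately show "real n * max 0 (ln l) \<le> ln (1 + l ^ n)"
    unfolding pow by (auto simp: max_def)
  \<comment> \<open>The excess \<open>ln 2\<close> depends on neither \<open>n\<close> nor
    \<open>l\<close>, so it disappears in the limit after division by \<open>n\<close>.\<close>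
  show "ln (1 + l ^ n) \<le> real n * max 0 (ln l) + ln 2"
  proof (cases "l \<le> 1")
    case True
    then have "1 + l ^ n \<le> 2"
      using assms power_le_one[of l n] by simp
    then have "ln (1 + l ^ n) \<le> ln 2"
      using assms by (subst ln_le_cancel_iff) (auto simp: add_pos_pos)
    moreover have "0 \<le> real n * max 0 (ln l)"
      by simp
    ultimately show ?thesis by linarith
  next
    case False
    then have "1 + l ^ n \<le> l ^ n * 2"
      using one_le_power[of l n] by simp
    then have "ln (1 + l ^ n) \<le> ln (l ^ n * 2)"
      using assms by (subst ln_le_cancel_iff) (auto simp: add_pos_pos)
    also have "\<dots> = real n * max 0 (ln l) + ln 2"
      using False assms by (simp add: ln_mult_pos pow)
    finally show ?thesis .
  qed
qed

lemma le_of_le_add_div_two_power: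
  fixes a b c :: real
  assumes "\<And>j. a \<le> b + c / 2 ^ j"
  shows "a \<le> b"
proof -
  have "(\<lambda>j. b + c * (1 / 2) ^ j) \<longlonglongrightarrow> b + c * 0"
    by (intro tendsto_intros LIMSEQ_power_zero) simp
  then show ?thesis
    using assms by (intro LIMSEQ_le_const[of _ b a]) (auto simp: power_divide)
qed

text \<open>The \<open>2 ^ j\<close>-th powers make \<open>x \<mapsto> ln (1 + exp x)\<close> converge, after rescaling, to the
  hinge function \<open>max 0\<close>; moving the kink to \<open>a\<close> amounts to replacing \<open>P\<close> by
  \<open>exp (- a s) P s\<close>.\<close>

lemma sum_hinge_eigenvalues_mono:
  fixes P Q :: "real \<Rightarrow> complex ^ 'n ^ 'n"
  assumes P: "hermitian_group P" and Q: "hermitian_group Q" and s: "0 < s" "s \<le> r"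
    and U: "unitary_mat U" "sandwich P Q s = U ** diag_mat l ** adjoint_mat U" "\<And>i. 0 < l i"
    and V: "unitary_mat V" "sandwich P Q r = V ** diag_mat m ** adjoint_mat V" "\<And>i. 0 < m i"
  shows "(\<Sum>i\<in>UNIV. max 0 (ln (l i) / s - a)) \<le> (\<Sum>i\<in>UNIV. max 0 (ln (m i) / r - a))"
proof -
  define P' where "P' s = exp (- a * s) *\<^sub>R P s" for s
  have P': "hermitian_group P'"
    unfolding P'_def by (rule hermitian_group_scale[OF P])
  have scale: "sandwich P' Q t = W ** diag_mat (\<lambda>i. exp (- a * t) * k i) ** adjoint_mat W"
    if "sandwich P Q t = W ** diag_mat k ** adjoint_mat W" for t W k
  proof -
    have "diag_mat (\<lambda>i. exp (- a * t) * k i) = exp (- a * t) *\<^sub>R diag_mat k"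
      by (simp add: vec_eq_iff diag_mat_def scaleR_conv_of_real[where 'a = complex])
    then show ?thesis
      using that by (simp add: sandwich_def P'_def scaleR_matrix_mult_left scaleR_matrix_mult_right)
  qed
  define x where "x i = exp (- a * s) * l i" for i
  define y where "y i = exp (- a * r) * m i" for i
  have xy: "0 < x i" "0 < y i" for i
    using U(3) V(3) by (simp_all add: x_def y_def)
  have detx: "ln (sandwich_det j P' Q s) = (\<Sum>i\<in>UNIV. ln (1 + x i ^ 2 ^ j))" for j
    unfolding sandwich_det_diagonalized[OF U(1) scale[OF U(2)]] x_def[symmetric]
    using xy
    by (intro ln_prod finite) (metis add_pos_pos less_irrefl zero_less_one zero_less_power)
  have dety: "ln (sandwich_det j P' Q r) = (\<Sum>i\<in>UNIV. ln (1 + y i ^ 2 ^ j))" for j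
    unfolding sandwich_det_diagonalized[OF V(1) scale[OF V(2)]] y_def[symmetric]
    using xy
    by (intro ln_prod finite) (metis add_pos_pos less_irrefl zero_less_one zero_less_power)
  define X where "X = (\<Sum>i\<in>UNIV. max 0 (ln (x i)))"
  define Y where "Y = (\<Sum>i\<in>UNIV. max 0 (ln (y i)))"
  define c where "c = real CARD('n) * ln 2"
  have "X \<le> s / r * Y + c / 2 ^ j" for j
  proof -
    have "2 ^ j * X \<le> ln (sandwich_det j P' Q s)"
      unfolding detx X_def sum_distrib_left
      using ln_one_plus_power_bounds(1)[OF xy(1), where n = "2 ^ j"] by (intro sum_mono) simp
    also have "\<dots> \<le> s / r * ln (sandwich_det j P' Q r) + (1 - s / r) * c"
      unfolding c_def using s by (intro ln_sandwich_det_le_chord P' Q) auto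
    also have "s / r * ln (sandwich_det j P' Q r) \<le> s / r * (2 ^ j * Y + c)"
    proof (rule mult_left_mono)
      have "ln (sandwich_det j P' Q r) \<le> (\<Sum>i\<in>UNIV. 2 ^ j * max 0 (ln (y i)) + ln 2)"
        unfolding dety
        using ln_one_plus_power_bounds(2)[OF xy(2), where n = "2 ^ j"] by (intro sum_mono) simp
      then show "ln (sandwich_det j P' Q r) \<le> 2 ^ j * Y + c"
        by (simp add: sum.distrib Y_def c_def sum_distrib_left)
    qed (use s in simp)
    finally have "2 ^ j * X \<le> s / r * (2 ^ j * Y + c) + (1 - s / r) * c"
      by simp
    also have "\<dots> = 2 ^ j * (s / r * Y + c / 2 ^ j)"
      by (simp add: algebra_simps)
    finally show ?thesis
      by simp
  qed
  then have "X \<le> s / r * Y"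
    by (rule le_of_le_add_div_two_power)
  moreover have "X = s * (\<Sum>i\<in>UNIV. max 0 (ln (l i) / s - a))"
    unfolding X_def sum_distrib_left
  proof (intro sum.cong refl)
    fix i
    have "ln (x i) = s * (ln (l i) / s - a)"
      using s U(3)[of i] by (simp add: x_def ln_mult_pos field_simps)
    then show "max 0 (ln (x i)) = s * max 0 (ln (l i) / s - a)"
      using s by (simp add: max_mult_distrib_left)
  qed
  moreover have "Y = r * (\<Sum>i\<in>UNIV. max 0 (ln (m i) / r - a))"
    unfolding Y_def sum_distrib_left
  proof (intro sum.cong refl)
    fix i
    have "ln (y i) = r * (ln (m i) / r - a)"
      using s V(3)[of i] by (simp add: y_def ln_mult_pos field_simps)
    then show "max 0 (ln (y i)) = r * max 0 (ln (m i) / r - a)"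
      using s by (simp add: max_mult_distrib_left)
  qed
  ultimately show ?thesis
    using s by simp
qed

section \<open>Sums of squares as integrals of hinge sums\<close>

lemma has_integral_hinge:
  fixes z :: real
  assumes "0 \<le> z" "z \<le> L"
  shows "((\<lambda>a. max 0 (z - a)) has_integral z\<^sup>2 / 2) {0..L}"
proof -
  have "((\<lambda>a. z - a) has_integral (- (z - z)\<^sup>2 / 2) - (- (z - 0)\<^sup>2 / 2)) {0..z}"
    using assms(1)
    by (intro fundamental_theorem_of_calculus)
      (auto intro!: derivative_eq_intros simp: field_simps
        simp flip: has_real_derivative_iff_has_vector_derivative)
  then have "((\<lambda>a. max 0 (z - a)) has_integral z\<^sup>2 / 2) {0..z}"
    by (subst has_integral_cong[of _ _ "\<lambda>a. z - a"]) auto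
  moreover have "((\<lambda>a. max 0 (z - a)) has_integral 0) {z..L}"
    by (subst has_integral_cong[of _ _ "\<lambda>a. 0"]) auto
  ultimately show ?thesis
    using has_integral_combine[OF assms, of "\<lambda>a. max 0 (z - a)" "z\<^sup>2 / 2" 0] by simp
qed

text \<open>Integrating the hypothesis over the kink \<open>a\<close> turns each hinge into half a
  square.\<close>

lemma sum_squares_le_of_hinges:
  fixes x y :: "'a \<Rightarrow> real"
  assumes fin: "finite I"
    and le: "\<And>a. 0 \<le> a \<Longrightarrow> (\<Sum>i\<in>I. max 0 (\<bar>x i\<bar> - a)) \<le> (\<Sum>i\<in>I. max 0 (\<bar>y i\<bar> - a))"
  shows "(\<Sum>i\<in>I. (x i)\<^sup>2) \<le> (\<Sum>i\<in>I. (y i)\<^sup>2)"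
proof -
  \<comment> \<open>A common bound for all entries, so that every hinge is integrated over its whole
    support in the same interval.\<close>
  define L where "L = (\<Sum>i\<in>I. \<bar>x i\<bar> + \<bar>y i\<bar>)"
  have L: "\<bar>x i\<bar> \<le> L" "\<bar>y i\<bar> \<le> L" if "i \<in> I" for i
    using member_le_sum[OF that, of "\<lambda>i. \<bar>x i\<bar> + \<bar>y i\<bar>"] fin by (auto simp: L_def)
  have "(\<Sum>i\<in>I. \<bar>x i\<bar>\<^sup>2 / 2) \<le> (\<Sum>i\<in>I. \<bar>y i\<bar>\<^sup>2 / 2)"
  proof (rule has_integral_le)
    show "((\<lambda>a. \<Sum>i\<in>I. max 0 (\<bar>x i\<bar> - a)) has_integral (\<Sum>i\<in>I. \<bar>x i\<bar>\<^sup>2 / 2)) {0..L}"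
      "((\<lambda>a. \<Sum>i\<in>I. max 0 (\<bar>y i\<bar> - a)) has_integral (\<Sum>i\<in>I. \<bar>y i\<bar>\<^sup>2 / 2)) {0..L}"
      by (intro has_integral_sum fin has_integral_hinge abs_ge_zero L; assumption)+
  qed (use le in auto)
  then show ?thesis
    by (simp add: sum_divide_distrib[symmetric])
qed

text \<open>The squared Frobenius norm is the trace of \<open>adjoint_mat M ** M\<close>, and the
  trace is invariant under unitary conjugation.\<close>

lemma norm_diagonalized:
  fixes U :: "complex ^ 'n ^ 'n"
  assumes U: "unitary_mat U"
  shows "norm (U ** diag_mat d ** adjoint_mat U) = sqrt (\<Sum>i\<in>UNIV. (d i)\<^sup>2)"
proof -
  define M where "M = U ** diag_mat d ** adjoint_mat U"
  have "trace (adjoint_mat M ** M) = (\<Sum>i\<in>UNIV. \<Sum>j\<in>UNIV. of_real ((cmod (M $ j $ i))\<^sup>2))"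
    unfolding complex_norm_square
    by (simp add: trace_def matrix_matrix_mult_def adjoint_mat_def mult.commute)
  also have "\<dots> = (\<Sum>i\<in>UNIV. \<Sum>j\<in>UNIV. of_real ((cmod (M $ i $ j))\<^sup>2))"
    by (rule sum.swap)
  finally have "trace (adjoint_mat M ** M) = of_real (\<Sum>i\<in>UNIV. \<Sum>j\<in>UNIV. (cmod (M $ i $ j))\<^sup>2)"
    by simp
  moreover have "trace (adjoint_mat M ** M) = of_real (\<Sum>i\<in>UNIV. (d i)\<^sup>2)"
  proof -
    have "adjoint_mat M = M"
      by (simp add: M_def adjoint_mat_mult matrix_mul_assoc)
    then have "adjoint_mat M ** M = U ** (diag_mat (\<lambda>i. (d i)\<^sup>2) ** adjoint_mat U)"
      using unitary_mult_cancel[OF U, of "diag_mat d" "diag_mat d"]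
      by (simp add: M_def[symmetric] diag_mat_mult power2_eq_square matrix_mul_assoc)
    then have "trace (adjoint_mat M ** M) = trace (diag_mat (\<lambda>i. (d i)\<^sup>2) ** adjoint_mat U ** U)"
      by (metis trace_mul_sym)
    also have "\<dots> = trace (diag_mat (\<lambda>i. (d i)\<^sup>2) :: complex ^ 'n ^ 'n)"
      using U by (simp add: unitary_mat_def flip: matrix_mul_assoc)
    finally show ?thesis
      by (simp add: trace_def diag_mat_def)
  qed
  ultimately have "(\<Sum>i\<in>UNIV. \<Sum>j\<in>UNIV. (cmod (M $ i $ j))\<^sup>2) = (\<Sum>i\<in>UNIV. (d i)\<^sup>2)"
    by (simp only: of_real_eq_iff)
  then show ?thesis
    by (simp add: M_def norm_eq_frobenius)
qed

text \<open>For \<open>a \<ge> 0\<close> a hinge of \<open>\<bar>z\<bar>\<close> is the sum of the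
  hinges of \<open>z\<close> and \<open>- z\<close>. The first are monotone for \<open>P\<close> and
  \<open>Q\<close>, the second for the reversed groups, whose \<open>sandwich\<close> has the
  inverse eigenvalues.\<close>

lemma norm_log_sandwich_mono:
  fixes P Q :: "real \<Rightarrow> complex ^ 'n ^ 'n"
  assumes P: "hermitian_group P" and Q: "hermitian_group Q" and s: "0 < s" "s \<le> r"
  shows "norm (mat_log (sandwich P Q s)) / s \<le> norm (mat_log (sandwich P Q r)) / r"
proof -
  obtain U l where U: "unitary_mat U" "\<And>i. 0 < l i" "sandwich P Q s = U ** diag_mat l ** adjoint_mat U"
    using hpd_diagonalization[OF hpd_sandwich[OF P Q]] by blast
  obtain V m where V: "unitary_mat V" "\<And>i. 0 < m i" "sandwich P Q r = V ** diag_mat m ** adjoint_mat V"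
    using hpd_diagonalization[OF hpd_sandwich[OF P Q]] by blast
  define P' Q' where "P' s = P (- s)" and "Q' s = Q (- s)" for s
  have P': "hermitian_group P'" and Q': "hermitian_group Q'"
    unfolding P'_def Q'_def using P Q by (auto intro: hermitian_group_minus)
  have inverse: "sandwich P' Q' t = W ** diag_mat (\<lambda>i. inverse (k i)) ** adjoint_mat W"
    if "unitary_mat W" "\<And>i. 0 < k i" "sandwich P Q t = W ** diag_mat k ** adjoint_mat W" for W k t
  proof -
    define J where "J = W ** diag_mat (\<lambda>i. inverse (k i)) ** adjoint_mat W"
    have "sandwich P Q t ** J = mat 1"
      unfolding that(3) J_def unitary_mult_cancel[OF that(1)] diag_mat_mult
      using that(1) that(2)[THEN less_imp_neq] by (simp add: diag_mat_one unitary_mat_def)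
    moreover have "sandwich P' Q' t ** sandwich P Q t = mat 1"
    proof -
      have "sandwich P' Q' t ** sandwich P Q t
          = Q (- t / 2) ** (P (- t) ** (Q (- t / 2) ** Q (t / 2)) ** P t) ** Q (t / 2)"
        by (simp add: sandwich_def P'_def Q'_def matrix_mul_assoc)
      then show ?thesis
        by (simp add: hermitian_groupD(2,3)[OF P] hermitian_groupD(2,3)[OF Q])
    qed
    \<comment> \<open>A left inverse and a right inverse coincide; the latter is already
      diagonalized by \<open>W\<close>.\<close>
    ultimately show ?thesis
      unfolding J_def by (metis matrix_mul_assoc matrix_mul_lid matrix_mul_rid)
  qed
  define x where "x i = ln (l i) / s" for i
  define y where "y i = ln (m i) / r" for i
  have "(\<Sum>i\<in>UNIV. max 0 (\<bar>x i\<bar> - a)) \<le> (\<Sum>i\<in>UNIV. max 0 (\<bar>y i\<bar> - a))" if "0 \<le> a" for a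
  proof -
    have split: "max 0 (\<bar>z\<bar> - a) = max 0 (z - a) + max 0 (- z - a)" for z
      using that by (auto simp: max_def abs_if)
    have "(\<Sum>i\<in>UNIV. max 0 (x i - a)) \<le> (\<Sum>i\<in>UNIV. max 0 (y i - a))"
      unfolding x_def y_def by (rule sum_hinge_eigenvalues_mono[OF P Q s U(1,3,2) V(1,3,2)])
    moreover have "(\<Sum>i\<in>UNIV. max 0 (- x i - a)) \<le> (\<Sum>i\<in>UNIV. max 0 (- y i - a))"
      using sum_hinge_eigenvalues_mono[OF P' Q' s U(1) inverse[OF U] _ V(1) inverse[OF V], of a]
        U(2) V(2)
      by (simp add: x_def y_def ln_inverse)
    ultimately show ?thesis
      unfolding split sum.distrib by (rule add_mono)
  qed
  then have "(\<Sum>i\<in>UNIV. (x i)\<^sup>2) \<le> (\<Sum>i\<in>UNIV. (y i)\<^sup>2)"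
    by (intro sum_squares_le_of_hinges) auto
  moreover have "norm (mat_log (sandwich P Q s)) / s = sqrt (\<Sum>i\<in>UNIV. (x i)\<^sup>2)"
    unfolding mat_log_def U(3) mat_fun_diag[OF U(1)] norm_diagonalized[OF U(1)] x_def
    using s by (simp add: power_divide real_sqrt_divide flip: sum_divide_distrib)
  moreover have "norm (mat_log (sandwich P Q r)) / r = sqrt (\<Sum>i\<in>UNIV. (y i)\<^sup>2)"
    unfolding mat_log_def V(3) mat_fun_diag[OF V(1)] norm_diagonalized[OF V(1)] y_def
    using s by (simp add: power_divide real_sqrt_divide flip: sum_divide_distrib)
  ultimately show ?thesis
    by simp
qed

section \<open>The two distances expressed through \<open>sandwich\<close>\<close>

lemma delta_R_mat_powr:
  assumes "hpd_mat A" "hpd_mat B"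
  shows "delta_R (mat_powr A s) (mat_powr B s)
       = norm (mat_log (sandwich (mat_powr A) (\<lambda>s. mat_powr B (- s)) s))"
  by (simp add: delta_R_def sandwich_def mat_powr_mat_powr[OF assms(2)])

text \<open>The exponential form shows that the logarithm of the determinant is linear in
  \<open>s\<close>; \<open>c\<close> is the sum of the logarithms of the eigenvalues of
  \<open>A\<close>.\<close>

lemma det_mat_powr:
  fixes A :: "complex ^ 'n ^ 'n"
  assumes "hpd_mat A"
  obtains c where "\<And>s. det (mat_powr A s) = of_real (exp (c * s))"
proof -
  obtain U d where U: "unitary_mat U" and d: "\<And>i. 0 < d i"
    and A: "A = U ** diag_mat d ** adjoint_mat U"
    using hpd_diagonalization[OF assms] by blast
  have "det (mat_powr A s) = of_real (exp ((\<Sum>i\<in>UNIV. ln (d i)) * s))" for s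
  proof -
    have "(\<Prod>i\<in>UNIV. d i powr s) = (\<Prod>i\<in>UNIV. exp (ln (d i) * s))"
      using d[THEN less_imp_neq] by (intro prod.cong) (auto simp: powr_def mult.commute)
    then show ?thesis
      by (simp only: A mat_powr_diagonalized[OF U] det_diagonalized[OF U] sum_distrib_right
          exp_sum[OF finite])
  qed
  then show ?thesis
    by (rule that)
qed

text \<open>Congruence by \<open>mat_powr B (s / 2)\<close> turns
  \<open>mat_powr A s + mat_powr B s\<close> into \<open>mat 1 + sandwich P Q s\<close>. The
  remaining determinants contribute only a constant and a linear term, and the latter becomes
  constant on division by \<open>s\<close>.\<close>

lemma delta_S_sq_mat_powr:
  fixes A B :: "complex ^ 'n ^ 'n"
  assumes A: "hpd_mat A" and B: "hpd_mat B"
  obtains c where "\<And>s. delta_S_sq (mat_powr A s) (mat_powr B s)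
    = ln (sandwich_det 0 (mat_powr A) (\<lambda>s. mat_powr B (- s)) s) - CARD('n) * ln 2 + c * s"
proof -
  define P Q where "P = mat_powr A" and "Q = (\<lambda>s. mat_powr B (- s))"
  have P: "hermitian_group P" and Q: "hermitian_group Q" and B': "hermitian_group (mat_powr B)"
    unfolding P_def Q_def using A B by (auto intro: hermitian_group_minus hermitian_group_mat_powr)
  obtain a where a: "\<And>s. det (mat_powr A s) = of_real (exp (a * s))"
    using det_mat_powr[OF A] by blast
  obtain b where b: "\<And>s. det (mat_powr B s) = of_real (exp (b * s))"
    using det_mat_powr[OF B] by blast
  \<comment> \<open>The slope combines \<open>b\<close>, from the two factors \<open>H\<close>, with
    \<open>- (a + b) / 2\<close>, from the determinant of the product.\<close>
  have "delta_S_sq (mat_powr A s) (mat_powr B s)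
    = ln (sandwich_det 0 P Q s) - CARD('n) * ln 2 + (b - a) / 2 * s" for s
  proof -
    define H where "H = mat_powr B (s / 2)"
    have HQ: "H ** Q (s / 2) = mat 1" "Q (s / 2) ** H = mat 1" and HH: "H ** H = mat_powr B s"
      using hermitian_groupD(2,3)[OF B'] by (simp_all add: H_def Q_def)
    have "H ** sandwich P Q s ** H = (H ** Q (s / 2)) ** P s ** (Q (s / 2) ** H)"
      by (simp add: sandwich_def matrix_mul_assoc)
    then have "mat_powr A s + mat_powr B s = H ** (mat 1 + sandwich P Q s) ** H"
      by (simp add: HQ HH P_def matrix_add_ldistrib matrix_add_rdistrib add.commute)
    \<comment> \<open>Written as a matrix factor, the scalar \<open>1 / 2\<close> contributes
      \<open>(1 / 2) ^ CARD('n)\<close> through \<open>det_mul\<close>.\<close>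
    moreover have "(1 / 2) *\<^sub>R (mat_powr A s + mat_powr B s)
        = diag_mat (\<lambda>i. 1 / 2) ** (mat_powr A s + mat_powr B s)"
      by (simp add: vec_eq_iff diag_mat_mult_nth scaleR_conv_of_real[where 'a = complex])
    ultimately have "det ((1 / 2) *\<^sub>R (mat_powr A s + mat_powr B s))
        = det (diag_mat (\<lambda>i. 1 / 2) :: complex ^ 'n ^ 'n) * (det H * det H * det (mat 1 + sandwich P Q s))"
      by (simp add: det_mul)
    also have "det H * det H = of_real (exp (b * s))"
      using b[of s] by (simp add: HH flip: det_mul)
    also have "det (diag_mat (\<lambda>i. 1 / 2) :: complex ^ 'n ^ 'n) = of_real ((1 / 2) ^ CARD('n))"
      by (subst det_diagonal) (simp_all add: diag_mat_def)
    finally have "Re (det ((1 / 2) *\<^sub>R (mat_powr A s + mat_powr B s)))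
        = (1 / 2) ^ CARD('n) * (exp (b * s) * sandwich_det 0 P Q s)"
      by (simp add: sandwich_det_def del: of_real_power)
    then have "ln (Re (det ((1 / 2) *\<^sub>R (mat_powr A s + mat_powr B s))))
        = b * s + ln (sandwich_det 0 P Q s) - CARD('n) * ln 2"
      using sandwich_det_pos[OF P Q, of 0 s] by (simp only: ln_mult_pos exp_gt_zero
          mult_pos_pos zero_less_power half_gt_zero zero_less_one ln_exp ln_realpow ln_div) simp
    moreover have "Re (det (mat_powr A s ** mat_powr B s)) = exp (a * s + b * s)"
      by (simp add: det_mul a b exp_add flip: of_real_mult)
    ultimately show ?thesis
      by (simp add: delta_S_sq_def algebra_simps del: scaleR_add_right)
        (simp add: field_simps del: scaleR_add_right)
  qed
  then show ?thesis
    unfolding P_def Q_def by (rule that)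
qed

theorem theorem4p8:
  fixes A B :: "complex ^ 'n ^ 'n" and t u :: real
  assumes "hpd_mat A" and "hpd_mat B" and "1 \<le> t" and "t \<le> u"
  shows "inverse t * delta_R (mat_powr A t) (mat_powr B t)
           \<le> inverse u * delta_R (mat_powr A u) (mat_powr B u)
       \<and> inverse t * delta_S_sq (mat_powr A t) (mat_powr B t)
           \<le> inverse u * delta_S_sq (mat_powr A u) (mat_powr B u)"
proof
  define P Q where "P = mat_powr A" and "Q = (\<lambda>s. mat_powr B (- s))"
  have P: "hermitian_group P" and Q: "hermitian_group Q"
    unfolding P_def Q_def using assms by (auto intro: hermitian_group_minus hermitian_group_mat_powr)
  have t: "0 < t" "0 < u" "0 \<le> t" using assms by auto
  show "inverse t * delta_R (mat_powr A t) (mat_powr B t)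
           \<le> inverse u * delta_R (mat_powr A u) (mat_powr B u)"
    using norm_log_sandwich_mono[OF P Q t(1) assms(4)]
    by (simp add: delta_R_mat_powr[OF assms(1,2)] P_def Q_def divide_inverse_commute)
  obtain c where c: "\<And>s. delta_S_sq (mat_powr A s) (mat_powr B s)
      = ln (sandwich_det 0 P Q s) - CARD('n) * ln 2 + c * s"
    using delta_S_sq_mat_powr[OF assms(1,2)] unfolding P_def Q_def by blast
  \<comment> \<open>Subtracting the value at 0 makes the chord start at the origin, so the chord
    bound becomes monotonicity of the quotient by the parameter.\<close>
  have "ln (sandwich_det 0 P Q t) - CARD('n) * ln 2 \<le> t / u * (ln (sandwich_det 0 P Q u) - CARD('n) * ln 2)"
    using ln_sandwich_det_le_chord[OF P Q t(2,3) assms(4), of 0] by (simp add: algebra_simps)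
  then have "(ln (sandwich_det 0 P Q t) - CARD('n) * ln 2) / t
      \<le> (ln (sandwich_det 0 P Q u) - CARD('n) * ln 2) / u"
    using t by (simp add: field_simps)
  then show "inverse t * delta_S_sq (mat_powr A t) (mat_powr B t)
           \<le> inverse u * delta_S_sq (mat_powr A u) (mat_powr B u)"
    unfolding c using t by (simp add: inverse_eq_divide add_divide_distrib diff_divide_distrib)
qed

end
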